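(* Let $f$ be a Boolean function of $x_1,\dots,x_n$ computed by an abstract XAG with $r$ steps. Then $f$ is also computed by an abstract XAG with $r$ steps $x_i=L_{S_{1i}}\land L_{S_{2i}}$ ($n<i\le n+r$) in which, for every step $i$, $S_{1i}\not\subseteq S_{2i}$ and $S_{2i}\not\subseteq S_{1i}$.
   Context: $[m]=\{1,\dots,m\}$. For a set $S=\{i_1,\dots,i_k\}$ of indices, $L_S=x_{i_1}\oplus\cdots\oplus x_{i_k}$ (XOR), with $L_\emptyset=0$. An abstract XAG with $r$ steps for a Boolean function $f(x_1,\dots,x_n)$ is a sequence of steps $x_i=L_{S_{1i}}\land L_{S_{2i}}$ for $n<i\le n+r$, where $S_{1i},S_{2i}\subseteq[i-1]$ (so each step is the AND of two XORs of primary inputs and previously defined steps), together with an output set $S\subseteq[n+r]$ such that $f=L_S$ when every $x_i$ ($i>n$) is evaluated via its step definition. The number of steps $r$ is the number of AND gates.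
   Formalization: The formal statement adds the assumption that n ≥ 2 or r = 0; for n ≤ 1 and r ≥ 1 the claim is false, since the first step's two sets are subsets of [n], which has at most one element, so one always contains the other. *)

theory Defs
  imports Main
begin

definition lin :: "(nat \<Rightarrow> bool) \<Rightarrow> nat set \<Rightarrow> bool" where
  "lin x S = Finite_Set.fold (\<lambda>i b. x i \<noteq> b) False S"

(* On bool, exclusive or is disequality; the following are the recursion equations of L_S. *)

lemma lin_empty: "lin x {} \<longleftrightarrow> False"
  by (simp add: lin_def)

lemma lin_insert:
  assumes "finite S" and "i \<notin> S"
  shows "lin x (insert i S) \<longleftrightarrow> (x i \<noteq> lin x S)"
proof -
  interpret comp_fun_commute_on UNIV "\<lambda>i b. x i \<noteq> b"
    by unfold_locales (auto simp: fun_eq_iff)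
  show ?thesis
    unfolding lin_def by (rule fold_insert) (use assms in auto)
qed

(* The primary inputs are indexed 1..n, the steps n+1..n+r.  The maps S1 and S2 matter
   only on the step indices. *)

definition abstract_xag ::
  "nat \<Rightarrow> nat \<Rightarrow> (nat \<Rightarrow> nat set) \<Rightarrow> (nat \<Rightarrow> nat set) \<Rightarrow> nat set \<Rightarrow> bool" where
  "abstract_xag n r S1 S2 S \<longleftrightarrow>
     (\<forall>i\<in>{n<..n + r}. S1 i \<subseteq> {1..i - 1} \<and> S2 i \<subseteq> {1..i - 1}) \<and> S \<subseteq> {1..n + r}"

(* The assignment obtained from the input assignment x by evaluating the steps n+1..n+r in
   order.  Values of x outside 1..n are never read by an abstract XAG. *)

primrec run_steps ::
  "nat \<Rightarrow> (nat \<Rightarrow> nat set) \<Rightarrow> (nat \<Rightarrow> nat set) \<Rightarrow> (nat \<Rightarrow> bool) \<Rightarrow> nat \<Rightarrow> nat \<Rightarrow> bool" where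
  "run_steps n S1 S2 x 0 = x"
| "run_steps n S1 S2 x (Suc r) =
     (let y = run_steps n S1 S2 x r; i = n + Suc r
      in y(i := (lin y (S1 i) \<and> lin y (S2 i))))"

(* A Boolean function of x_1,...,x_n is a predicate on assignments; if it is computed by an
   abstract XAG on n inputs, it automatically depends on x 1,...,x n only. *)

definition xag_computes ::
  "nat \<Rightarrow> nat \<Rightarrow> (nat \<Rightarrow> nat set) \<Rightarrow> (nat \<Rightarrow> nat set) \<Rightarrow> nat set \<Rightarrow> ((nat \<Rightarrow> bool) \<Rightarrow> bool) \<Rightarrow> bool" where
  "xag_computes n r S1 S2 S f \<longleftrightarrow>
     abstract_xag n r S1 S2 S \<and> (\<forall>x. f x \<longleftrightarrow> lin (run_steps n S1 S2 x r) S)"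

end

(* If S1 is contained in S2, put A = L_S1 and B = L_(S2 - S1).  Then L_S1 AND L_S2 =
   A AND (A XOR B) = A XOR (A AND B), so the step can compute A AND B over disjoint sets
   instead, with the summand A absorbed into the XORs that use it.  If S1 or S2 - S1 is
   empty, the old step equals L_S1, and the new one may be the unused gate x_1 AND x_2. *)

theory Submission
  imports Defs
begin

lemma lin_Un_disjoint:
  assumes "finite A" "finite B" "A \<inter> B = {}"
  shows "lin x (A \<union> B) \<longleftrightarrow> (lin x A \<noteq> lin x B)"
  using assms by (induction A rule: finite_induct) (auto simp: lin_empty lin_insert)

text \<open>Both sets split along \<open>A \<inter> B\<close>, and the contribution of the common
  part cancels in the exclusive or.\<close>

lemma lin_sym_diff:
  assumes "finite A" "finite B"
  shows "lin x (sym_diff A B) \<longleftrightarrow> (lin x A \<noteq> lin x B)"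
proof -
  have "lin x (sym_diff A B) \<longleftrightarrow> (lin x (A - B) \<noteq> lin x (B - A))"
    using assms by (intro lin_Un_disjoint) auto
  moreover have "lin x ((A - B) \<union> (A \<inter> B)) \<longleftrightarrow> (lin x (A - B) \<noteq> lin x (A \<inter> B))"
    using assms by (intro lin_Un_disjoint) auto
  moreover have "lin x ((B - A) \<union> (A \<inter> B)) \<longleftrightarrow> (lin x (B - A) \<noteq> lin x (A \<inter> B))"
    using assms by (intro lin_Un_disjoint) auto
  moreover have "(A - B) \<union> (A \<inter> B) = A" "(B - A) \<union> (A \<inter> B) = B"
    by auto
  ultimately show ?thesis
    by auto
qed

lemma lin_fun_upd:
  assumes "finite A" "i \<notin> A"
  shows "lin (x(i := b)) A \<longleftrightarrow> lin x A"
  using assms by (induction A rule: finite_induct) (auto simp: lin_empty lin_insert)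

text \<open>Evaluation reads the two maps only at step indices. Hence overriding them at the index
  of a later step leaves all earlier values unchanged.\<close>

lemma run_steps_cong:
  assumes "\<And>i. i \<in> {n<..n + r} \<Longrightarrow> S1 i = T1 i" "\<And>i. i \<in> {n<..n + r} \<Longrightarrow> S2 i = T2 i"
  shows "run_steps n S1 S2 x r = run_steps n T1 T2 x r"
  using assms by (induction r) (auto simp: Let_def)

lemma and_lin_subset:
  assumes "finite B" "A \<subseteq> B"
  shows "lin x A \<and> lin x B \<longleftrightarrow> (lin x A \<noteq> (lin x A \<and> lin x (B - A)))"
proof -
  have "lin x (A \<union> (B - A)) \<longleftrightarrow> (lin x A \<noteq> lin x (B - A))"
    using assms by (intro lin_Un_disjoint) (auto intro: finite_subset)
  moreover have "A \<union> (B - A) = B"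
    using assms by auto
  ultimately show ?thesis
    by auto
qed

text \<open>The set \<open>E\<close> is the linear correction, and the bit \<open>c\<close> records
  whether the new gate over \<open>C\<close> and \<open>D\<close> contributes to the old value at
  all. All four are chosen before \<open>x\<close>, so one circuit serves every assignment. The
  indices \<open>a\<close> and \<open>b\<close> supply two incomparable singletons for the
  degenerate case.\<close>

lemma and_lin_incomparable_subset:
  assumes "finite M" "B \<subseteq> M" "A \<subseteq> B" "a \<in> M" "b \<in> M" "a \<noteq> b"
  shows "\<exists>C D E c. C \<subseteq> M \<and> D \<subseteq> M \<and> E \<subseteq> M \<and> \<not> C \<subseteq> D \<and> \<not> D \<subseteq> C \<and>
    (\<forall>x. lin x A \<and> lin x B \<longleftrightarrow> (lin x E \<noteq> (c \<and> lin x C \<and> lin x D)))"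
proof (cases "A = {} \<or> A = B")
  case True
  \<comment> \<open>The conjunction is \<open>lin x A\<close> in both cases: it is false if
    \<open>A\<close> is empty, and idempotence applies if \<open>A = B\<close>. So \<open>A\<close>
    alone is the correction and the gate over \<open>{a}\<close> and \<open>{b}\<close> is switched
    off.\<close>
  then show ?thesis
    using assms
    by (intro exI[of _ "{a}"] exI[of _ "{b}"] exI[of _ A] exI[of _ False])
      (auto simp: lin_empty)
next
  case False
  have "finite B"
    using assms finite_subset by blast
  then have "\<forall>x. lin x A \<and> lin x B \<longleftrightarrow> (lin x A \<noteq> (True \<and> lin x A \<and> lin x (B - A)))"
    using and_lin_subset[OF _ assms(3)] by simp
  \<comment> \<open>Two disjoint nonempty sets are incomparable.\<close>
  moreover have "\<not> A \<subseteq> B - A" "\<not> B - A \<subseteq> A"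
    using False assms by auto
  ultimately show ?thesis
    using assms(2,3) by (intro exI[of _ A] exI[of _ "B - A"] exI[of _ True] conjI) auto
qed

text \<open>Comparable operands reduce to the subset case, up to commutativity of the conjunction.
  Incomparable ones are kept, with empty correction and \<open>c\<close> true.\<close>

lemma and_lin_incomparable:
  assumes "finite M" "A \<subseteq> M" "B \<subseteq> M" "a \<in> M" "b \<in> M" "a \<noteq> b"
  obtains C D E c where "C \<subseteq> M" "D \<subseteq> M" "E \<subseteq> M" "\<not> C \<subseteq> D" "\<not> D \<subseteq> C"
    "\<And>x. lin x A \<and> lin x B \<longleftrightarrow> (lin x E \<noteq> (c \<and> lin x C \<and> lin x D))"
proof -
  consider "A \<subseteq> B" | "B \<subseteq> A" | "\<not> A \<subseteq> B" "\<not> B \<subseteq> A"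
    by blast
  then show thesis
  proof cases
    case 1
    obtain C D E c where "C \<subseteq> M" "D \<subseteq> M" "E \<subseteq> M" "\<not> C \<subseteq> D" "\<not> D \<subseteq> C"
      "\<And>x. lin x A \<and> lin x B \<longleftrightarrow> (lin x E \<noteq> (c \<and> lin x C \<and> lin x D))"
      using and_lin_incomparable_subset[OF assms(1,3) 1 assms(4-6)] by (elim exE conjE) metis
    then show ?thesis
      by (rule that)
  next
    case 2
    obtain C D E c where CDE: "C \<subseteq> M" "D \<subseteq> M" "E \<subseteq> M" "\<not> C \<subseteq> D" "\<not> D \<subseteq> C"
      "\<And>x. lin x B \<and> lin x A \<longleftrightarrow> (lin x E \<noteq> (c \<and> lin x C \<and> lin x D))"
      using and_lin_incomparable_subset[OF assms(1,2) 2 assms(4-6)] by (elim exE conjE) metis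
    show ?thesis
      using CDE(6) by (intro that[OF CDE(1-5), of c]) (simp add: conj_commute)
  next
    case 3
    then show ?thesis
      using that[of A B "{}" True] assms(2,3) by (simp add: lin_empty)
  qed
qed

text \<open>Rather than a single output, the induction preserves all linear combinations of the
  values computed so far.\<close>

lemma incomparable_steps:
  assumes "n \<ge> 2 \<or> r = 0"
    and "\<forall>i\<in>{n<..n + r}. S1 i \<subseteq> {1..i - 1} \<and> S2 i \<subseteq> {1..i - 1}"
  shows "\<exists>T1 T2. (\<forall>i\<in>{n<..n + r}. T1 i \<subseteq> {1..i - 1} \<and> T2 i \<subseteq> {1..i - 1} \<and>
      \<not> T1 i \<subseteq> T2 i \<and> \<not> T2 i \<subseteq> T1 i) \<and>
    (\<forall>S \<subseteq> {1..n + r}. \<exists>T \<subseteq> {1..n + r}. \<forall>x.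
      lin (run_steps n S1 S2 x r) S \<longleftrightarrow> lin (run_steps n T1 T2 x r) T)"
  using assms
proof (induction r)
  case 0
  then show ?case
    by auto
next
  case (Suc r)
  define i where "i = n + Suc r"
  define M where "M = {1..n + r}"
  have i: "i \<notin> M" "{1..n + Suc r} = insert i M" "{1..i - 1} = M"
    by (auto simp: i_def M_def)
  have fin: "finite A" if "A \<subseteq> M" for A
    using that finite_subset unfolding M_def by blast
  obtain T1 T2 where T:
    "\<forall>j\<in>{n<..n + r}. T1 j \<subseteq> {1..j - 1} \<and> T2 j \<subseteq> {1..j - 1} \<and>
      \<not> T1 j \<subseteq> T2 j \<and> \<not> T2 j \<subseteq> T1 j"
    and rep: "\<forall>S \<subseteq> M. \<exists>T \<subseteq> M. \<forall>x.
      lin (run_steps n S1 S2 x r) S \<longleftrightarrow> lin (run_steps n T1 T2 x r) T"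
  proof -
    have "n \<ge> 2 \<or> r = 0" "\<forall>j\<in>{n<..n + r}. S1 j \<subseteq> {1..j - 1} \<and> S2 j \<subseteq> {1..j - 1}"
      using Suc.prems by simp_all
    from Suc.IH[OF this] that show thesis
      unfolding M_def by metis
  qed
  have "S1 i \<subseteq> M" "S2 i \<subseteq> M"
    using bspec[OF Suc.prems(2), of i] unfolding i(3) by (auto simp: i_def)
  \<comment> \<open>The operands of the old step are themselves linear combinations of old values,
    so they can be rewritten over the values of the new circuit.\<close>
  then obtain A B where AB: "A \<subseteq> M" "B \<subseteq> M"
    "\<And>x. lin (run_steps n S1 S2 x r) (S1 i) \<longleftrightarrow> lin (run_steps n T1 T2 x r) A"
    "\<And>x. lin (run_steps n S1 S2 x r) (S2 i) \<longleftrightarrow> lin (run_steps n T1 T2 x r) B"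
    using rep by meson
  \<comment> \<open>There is at least one step here, so the assumption gives
    \<open>n \<ge> 2\<close>, and the first two inputs can feed a dummy gate.\<close>
  have "1 \<in> M" "2 \<in> M" "1 \<noteq> (2::nat)"
    using Suc.prems(1) by (auto simp: M_def)
  from and_lin_incomparable[OF fin[OF order_refl] AB(1,2) this]
  obtain C D E c where CDE: "C \<subseteq> M" "D \<subseteq> M" "E \<subseteq> M" "\<not> C \<subseteq> D" "\<not> D \<subseteq> C"
    "\<And>x. lin x A \<and> lin x B \<longleftrightarrow> (lin x E \<noteq> (c \<and> lin x C \<and> lin x D))"
    by metis
  define U1 U2 where "U1 = T1(i := C)" and "U2 = T2(i := D)"
  define u v where "u = (\<lambda>x. run_steps n S1 S2 x r)" and "v = (\<lambda>x. run_steps n T1 T2 x r)"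
  have "run_steps n U1 U2 x r = v x" for x
    unfolding v_def by (rule run_steps_cong) (auto simp: U1_def U2_def i_def)
  then have runU: "run_steps n U1 U2 x (Suc r) = (v x)(i := lin (v x) C \<and> lin (v x) D)" for x
    by (simp add: Let_def U1_def U2_def i_def)
  \<comment> \<open>The old value of step \<open>i\<close> is written in terms of
    \<open>v x\<close>, the new assignment before step \<open>i\<close> is added.\<close>
  have runS: "run_steps n S1 S2 x (Suc r) =
      (u x)(i := (lin (v x) E \<noteq> (c \<and> lin (v x) C \<and> lin (v x) D)))" for x
    using AB(3,4) CDE(6)[of "v x"] by (simp add: Let_def u_def v_def i_def)
  have "\<exists>T \<subseteq> insert i M. \<forall>x.
      lin (run_steps n S1 S2 x (Suc r)) S \<longleftrightarrow> lin (run_steps n U1 U2 x (Suc r)) T"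
    if S: "S \<subseteq> insert i M" for S
  proof -
    have S': "S - {i} \<subseteq> M"
      using S by auto
    then obtain T where T: "T \<subseteq> M" "\<And>x. lin (u x) (S - {i}) \<longleftrightarrow> lin (v x) T"
      using rep unfolding u_def v_def by meson
    show ?thesis
    proof (cases "i \<in> S")
      \<comment> \<open>Neither \<open>S\<close> nor its translation \<open>T\<close> mentions
        \<open>i\<close>, so the values set at \<open>i\<close> do not matter.\<close>
      case False
      then have "S - {i} = S"
        by auto
      then have "S \<subseteq> M" "\<And>x. lin (u x) S \<longleftrightarrow> lin (v x) T"
        using S' T(2) by simp_all
      moreover have "i \<notin> T"
        using T(1) i(1) by auto
      ultimately have "lin (run_steps n S1 S2 x (Suc r)) S \<longleftrightarrow>
          lin (run_steps n U1 U2 x (Suc r)) T" for x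
        unfolding runS runU using False T(1) by (simp add: lin_fun_upd fin)
      with T(1) show ?thesis
        by blast
    next
      case True
      \<comment> \<open>Here \<open>lin y S\<close> is \<open>y i\<close> xor the rest. The rest
        translates to \<open>T\<close>, while \<open>y i\<close> contributes the correction
        \<open>E\<close> and, if \<open>c\<close> holds, the new gate \<open>i\<close>. As
        \<open>T\<close> and \<open>E\<close> may overlap, their symmetric difference is taken
        instead of their union.\<close>
      define F where "F = sym_diff T E"
      define G where "G = (if c then insert i F else F)"
      have F: "F \<subseteq> M" "i \<notin> F" "finite F"
        using T(1) CDE(3) i(1) fin by (auto simp: F_def)
      have "lin (run_steps n S1 S2 x (Suc r)) S \<longleftrightarrow> lin (run_steps n U1 U2 x (Suc r)) G" for x
      proof -
        have "lin y S \<longleftrightarrow> (y i \<noteq> lin y (S - {i}))" for y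
          using lin_insert[of "S - {i}" i y] True fin[OF S'] by (simp add: insert_absorb)
        then have "lin (run_steps n S1 S2 x (Suc r)) S \<longleftrightarrow>
            ((lin (v x) E \<noteq> (c \<and> lin (v x) C \<and> lin (v x) D)) \<noteq> lin (v x) T)"
          unfolding runS using fin[OF S'] by (simp add: lin_fun_upd T(2))
        moreover have "lin (v x) F \<longleftrightarrow> (lin (v x) T \<noteq> lin (v x) E)"
          unfolding F_def using T(1) CDE(3) fin by (intro lin_sym_diff) auto
        ultimately show ?thesis
          unfolding runU G_def using F by (auto simp: lin_insert lin_fun_upd)
      qed
      moreover have "G \<subseteq> insert i M"
        using F by (auto simp: G_def)
      ultimately show ?thesis
        by blast
    qed
  qed
  moreover have "\<forall>j\<in>{n<..n + Suc r}. U1 j \<subseteq> {1..j - 1} \<and> U2 j \<subseteq> {1..j - 1} \<and>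
      \<not> U1 j \<subseteq> U2 j \<and> \<not> U2 j \<subseteq> U1 j"
  proof
    fix j assume "j \<in> {n<..n + Suc r}"
    then consider "j = i" | "j \<in> {n<..n + r}" "j \<noteq> i"
      by (force simp: i_def)
    then show "U1 j \<subseteq> {1..j - 1} \<and> U2 j \<subseteq> {1..j - 1} \<and> \<not> U1 j \<subseteq> U2 j \<and> \<not> U2 j \<subseteq> U1 j"
    proof cases
      case 1
      show ?thesis
        unfolding 1 i(3) using CDE by (simp add: U1_def U2_def)
    next
      case 2
      with T show ?thesis
        by (simp add: U1_def U2_def)
    qed
  qed
  ultimately show ?case
    unfolding i(2) by (intro exI[of _ U1] exI[of _ U2]) simp
qed

theorem theorem1:
  fixes n r :: nat
    and f :: "(nat \<Rightarrow> bool) \<Rightarrow> bool"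
    and S1 S2 :: "nat \<Rightarrow> nat set"
    and S :: "nat set"
  assumes "xag_computes n r S1 S2 S f"
    and "n \<ge> 2 \<or> r = 0"
  shows "\<exists>T1 T2 T. xag_computes n r T1 T2 T f \<and>
           (\<forall>i\<in>{n<..n + r}. \<not> T1 i \<subseteq> T2 i \<and> \<not> T2 i \<subseteq> T1 i)"
proof -
  have S: "\<forall>i\<in>{n<..n + r}. S1 i \<subseteq> {1..i - 1} \<and> S2 i \<subseteq> {1..i - 1}" "S \<subseteq> {1..n + r}"
    and f: "\<And>x. f x \<longleftrightarrow> lin (run_steps n S1 S2 x r) S"
    using assms(1) unfolding xag_computes_def abstract_xag_def by auto
  obtain T1 T2 where T: "\<forall>i\<in>{n<..n + r}. T1 i \<subseteq> {1..i - 1} \<and> T2 i \<subseteq> {1..i - 1} \<and>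
      \<not> T1 i \<subseteq> T2 i \<and> \<not> T2 i \<subseteq> T1 i"
    and rep: "\<forall>S \<subseteq> {1..n + r}. \<exists>T \<subseteq> {1..n + r}. \<forall>x.
      lin (run_steps n S1 S2 x r) S \<longleftrightarrow> lin (run_steps n T1 T2 x r) T"
    using incomparable_steps[OF assms(2) S(1)] by blast
  \<comment> \<open>The output is one of the preserved linear combinations, and \<open>U\<close> is
    its translation.\<close>
  obtain U where "U \<subseteq> {1..n + r}"
    "\<And>x. lin (run_steps n S1 S2 x r) S \<longleftrightarrow> lin (run_steps n T1 T2 x r) U"
    using rep S(2) by meson
  with T f have "xag_computes n r T1 T2 U f"
    by (simp add: xag_computes_def abstract_xag_def)
  with T show ?thesis
    by blast
qed

end
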